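(* Let $\alpha_0$ be a norm on $V$, let $\mathcal A\subseteq\mathscr N_{\alpha_0}(V)$ be nonempty and bounded, and put $D=\operatorname{diam}(\mathcal A)$ (with respect to $d_\infty$). Then $$c_{\mathcal A}(v)=e^{-D/2}\sup_{\gamma\in\mathcal A}\gamma(v)\qquad(v\in V)$$ defines a norm satisfying $$\sup_{\gamma\in\mathcal A}d_\infty(c_{\mathcal A},\gamma)\le\frac D2.$$ Moreover $D/2$ is the smallest possible radius of a (closed) ball of $\mathscr N_{\alpha_0}(V)$ containing $\mathcal A$. Hence every nonempty bounded family has circumradius exactly half its diameter.
   Context: Let $F$ and $E$ be finite extensions of $\mathbb Q_p$, with a fixed (non-Archimedean, nontrivial) absolute value $|\cdot|$ on $E$. Let $\mathbb G$ be a reductive group over $F$ and $G=\mathbb G(F)$. Let $\pi_{\mathrm{sm}}$ be a smooth admissible $E$-representation of $G$, let $\sigma_{\mathrm{alg}}$ be a finite-dimensional algebraic $E$-representation of $\operatorname{Res}_{F/\mathbb Q_p}\mathbb G$ (viewed as a representation of $G$), and put $V=\pi_{\mathrm{sm}}\otimes_E\sigma_{\mathrm{alg}}$ with the diagonal $G$-action. A norm on $V$ is a function $\alpha:V\to\mathbb R_{\ge0}$ with $\alpha(\lambda v)=|\lambda|\alpha(v)$, $\alpha(v+w)\le\max\{\alpha(v),\alpha(w)\}$ for $\lambda\in E$, $v,w\in V$, and $\alpha(v)=0\Rightarrow v=0$. For norms $\alpha,\beta$ put $d_\infty(\alpha,\beta)=\sup_{v\in V\setminus\{0\}}\left|\log\frac{\alpha(v)}{\beta(v)}\right|\in[0,+\infty]$.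 The finite-distance component of $\alpha_0$ is $\mathscr N_{\alpha_0}(V)=\{\alpha:\ d_\infty(\alpha,\alpha_0)<\infty\}$; $d_\infty$ restricts to a genuine metric on it. The circumradius of a bounded subset is the infimum of the radii of closed balls containing it. *)

theory Defs
  imports "HOL-Analysis.Analysis" "HOL-Algebra.Algebraic_Closure_Type" "HOL-Library.Poly_Mapping"
begin

section \<open>Absolute values and \<open>p\<close>-adic fields\<close>

definition nonarch_absolute_value :: "('k::field \<Rightarrow> real) \<Rightarrow> bool" where
  "nonarch_absolute_value N \<longleftrightarrow>
     (\<forall>x. 0 \<le> N x) \<and> (\<forall>x. N x = 0 \<longleftrightarrow> x = 0) \<and>
     (\<forall>x y. N (x * y) = N x * N y) \<and> (\<forall>x y. N (x + y) \<le> max (N x) (N y))"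

definition nontrivial_absolute_value :: "('k::field \<Rightarrow> real) \<Rightarrow> bool" where
  "nontrivial_absolute_value N \<longleftrightarrow> (\<exists>x. x \<noteq> 0 \<and> N x \<noteq> 1)"

text \<open>The field of \<open>p\<close>-adic numbers as the completion of the rationals with respect to the
  \<open>p\<close>-adic absolute value: a complete valued field in which the rationals are dense and carry the
  \<open>p\<close>-adic absolute value (which is determined by its values on the integers).\<close>

definition is_padic_field :: "nat \<Rightarrow> ('q::field_char_0 \<Rightarrow> real) \<Rightarrow> bool" where
  "is_padic_field p N \<longleftrightarrow>
     Factorial_Ring.prime p \<and> nonarch_absolute_value N \<and>
     (\<forall>n::int. n \<noteq> 0 \<longrightarrow> N (of_int n) = inverse (real p ^ multiplicity (int p) n)) \<and>
     (\<forall>x. \<forall>e>0. \<exists>r::rat. N (x - of_rat r) < e) \<and>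
     Metric_space.mcomplete UNIV (\<lambda>x y. N (x - y))"

definition field_embedding :: "('k::field \<Rightarrow> 'l::field) \<Rightarrow> bool" where
  "field_embedding \<phi> \<longleftrightarrow>
     \<phi> 1 = 1 \<and> (\<forall>x y. \<phi> (x + y) = \<phi> x + \<phi> y) \<and> (\<forall>x y. \<phi> (x * y) = \<phi> x * \<phi> y)"

definition finite_dim :: "('k::field \<Rightarrow> 'v::ab_group_add \<Rightarrow> 'v) \<Rightarrow> 'v set \<Rightarrow> bool" where
  "finite_dim sc U \<longleftrightarrow> (\<exists>B. finite B \<and> U \<subseteq> module.span sc B)"

definition vs_basis :: "('k::field \<Rightarrow> 'v::ab_group_add \<Rightarrow> 'v) \<Rightarrow> 'v set \<Rightarrow> bool" where
  "vs_basis sc B \<longleftrightarrow> \<not> module.dependent sc B \<and> module.span sc B = UNIV"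

definition finite_extension :: "('k::field \<Rightarrow> 'l::field) \<Rightarrow> bool" where
  "finite_extension \<phi> \<longleftrightarrow> field_embedding \<phi> \<and> finite_dim (\<lambda>a x. \<phi> a * x) UNIV"


section \<open>Linear algebraic groups over a field of characteristic zero\<close>

text \<open>\<open>'i \<Rightarrow>\<^sub>0 nat\<close> is the type of monomials in variables \<open>'i\<close>, so \<open>('i \<Rightarrow>\<^sub>0 nat) \<Rightarrow>\<^sub>0 'k\<close> is the
  type of polynomials. They are evaluated at \<open>x\<close> after mapping the coefficients along \<open>\<phi>\<close>.\<close>

type_synonym ('i, 'k) mpolynomial = "('i \<Rightarrow>\<^sub>0 nat) \<Rightarrow>\<^sub>0 'k"

definition mpeval :: "('k::field \<Rightarrow> 'l::field) \<Rightarrow> ('i \<Rightarrow> 'l) \<Rightarrow> ('i, 'k) mpolynomial \<Rightarrow> 'l" where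
  "mpeval \<phi> x P =
     (\<Sum>m\<in>Poly_Mapping.keys P. \<phi> (Poly_Mapping.lookup P m) *
        (\<Prod>i\<in>Poly_Mapping.keys m. x i ^ Poly_Mapping.lookup m i))"

text \<open>The points, over an extension \<open>\<phi>\<close> of the base field, of the closed subscheme of the
  general linear group cut out by the polynomials \<open>S\<close> in the matrix entries.\<close>

definition gpoints ::
  "('k::field \<Rightarrow> 'l::field) \<Rightarrow> ('n::finite \<times> 'n, 'k) mpolynomial set \<Rightarrow> ('l^'n^'n) set" where
  "gpoints \<phi> S = {g. invertible g \<and> (\<forall>f\<in>S. mpeval \<phi> (\<lambda>(i, j). g $ i $ j) f = 0)}"

definition matrix_subgroup :: "(('l::field)^'n^'n::finite) set \<Rightarrow> bool" where
  "matrix_subgroup H \<longleftrightarrow>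
     mat 1 \<in> H \<and> (\<forall>g\<in>H. invertible g \<and> matrix_inv g \<in> H) \<and> (\<forall>g\<in>H. \<forall>h\<in>H. g ** h \<in> H)"

definition zariski_closed :: "(('l::field)^'n^'n::finite) set \<Rightarrow> bool" where
  "zariski_closed U \<longleftrightarrow> (\<exists>T. U = gpoints (\<lambda>a. a) T)"

definition zariski_connected :: "(('l::field)^'n^'n::finite) set \<Rightarrow> bool" where
  "zariski_connected U \<longleftrightarrow>
     \<not> (\<exists>Y Z. zariski_closed Y \<and> zariski_closed Z \<and> U \<subseteq> Y \<union> Z \<and> U \<inter> Y \<inter> Z = {} \<and>
           U \<inter> Y \<noteq> {} \<and> U \<inter> Z \<noteq> {})"

definition unipotent :: "('l::field)^'n^'n::finite \<Rightarrow> bool" where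
  "unipotent u \<longleftrightarrow> (\<exists>k. (((**) (u - mat 1)) ^^ k) (mat 1) = 0)"

text \<open>In characteristic zero group schemes of finite type are smooth, so an algebraic group over
  the base field is given by equations over that field whose common zeros over the algebraic
  closure form a group. It is reductive if its geometric unipotent radical (the largest connected
  normal unipotent closed subgroup over the algebraic closure) is trivial; connectedness is not
  imposed.\<close>

definition reductive_group :: "('n::finite \<times> 'n, 'f::field) mpolynomial set \<Rightarrow> bool" where
  "reductive_group S \<longleftrightarrow>
     (let \<G> = gpoints to_ac S :: ('f alg_closure^'n^'n) set in
        matrix_subgroup \<G> \<and>
        (\<forall>U. U \<subseteq> \<G> \<and> zariski_closed U \<and> zariski_connected U \<and> matrix_subgroup U \<and>
             (\<forall>g\<in>\<G>. \<forall>u\<in>U. g ** u ** matrix_inv g \<in> U) \<and> (\<forall>u\<in>U. unipotent u)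
           \<longrightarrow> U = {mat 1}))"

abbreviation rational_points ::
  "('n::finite \<times> 'n, 'f::field) mpolynomial set \<Rightarrow> ('f^'n^'n) set" where
  "rational_points S \<equiv> gpoints (\<lambda>a. a) S"

definition matrix_group_topology ::
  "('f::field \<Rightarrow> real) \<Rightarrow> ('f^'n^'n::finite) set \<Rightarrow> ('f^'n^'n) topology" where
  "matrix_group_topology N G =
     subtopology
       (Metric_space.mtopology UNIV (\<lambda>g h. Max (range (\<lambda>(i, j). N (g $ i $ j - h $ i $ j))))) G"


section \<open>Smooth admissible and algebraic representations\<close>

definition group_rep ::
  "('e::field \<Rightarrow> 'v::ab_group_add \<Rightarrow> 'v) \<Rightarrow> (('f::field)^'n^'n::finite) set \<Rightarrow>
   ('f^'n^'n \<Rightarrow> 'v \<Rightarrow> 'v) \<Rightarrow> bool" where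
  "group_rep sc G \<rho> \<longleftrightarrow>
     vector_space sc \<and> (\<forall>g\<in>G. Vector_Spaces.linear sc sc (\<rho> g)) \<and>
     (\<forall>v. \<rho> (mat 1) v = v) \<and> (\<forall>g\<in>G. \<forall>h\<in>G. \<forall>v. \<rho> (g ** h) v = \<rho> g (\<rho> h v))"

definition smooth_admissible_rep ::
  "('f::field \<Rightarrow> real) \<Rightarrow> ('e::field \<Rightarrow> 'v::ab_group_add \<Rightarrow> 'v) \<Rightarrow> ('f^'n^'n::finite) set \<Rightarrow>
   ('f^'n^'n \<Rightarrow> 'v \<Rightarrow> 'v) \<Rightarrow> bool" where
  "smooth_admissible_rep N sc G \<rho> \<longleftrightarrow>
     group_rep sc G \<rho> \<and>
     (\<forall>v. openin (matrix_group_topology N G) {g \<in> G. \<rho> g v = v}) \<and>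
     (\<forall>K. K \<subseteq> G \<and> matrix_subgroup K \<and> openin (matrix_group_topology N G) K \<and>
          compactin (matrix_group_topology N G) K
        \<longrightarrow> finite_dim sc {v. \<forall>g\<in>K. \<rho> g v = v})"

text \<open>Weil restriction. Write \<open>E'\<close> for the algebraic closure of \<open>E\<close>. A basis \<open>C\<close> of \<open>F\<close> over
  \<open>\<rat>\<^sub>p\<close> identifies \<open>n \<times> n\<close> matrices over \<open>F \<otimes> E'\<close> with families \<open>x\<close> of \<open>n \<times> n\<close> matrices over
  \<open>E'\<close> indexed by \<open>C\<close>, the \<open>\<rat>\<^sub>p\<close>-coordinates of the Weil restriction; such a family stands for
  \<open>\<Sum>c\<in>C. c \<otimes> x c\<close>. As \<open>F \<otimes> E'\<close> is the product of copies of \<open>E'\<close> indexed by the embeddings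
  \<open>\<tau>\<close> of \<open>F\<close> into \<open>E'\<close> over \<open>\<rat>\<^sub>p\<close>, equations and multiplication can be tested on the
  components \<open>weil_component C \<tau> x\<close>.\<close>

definition embeddings_over ::
  "('q::field \<Rightarrow> 'f::field) \<Rightarrow> ('q \<Rightarrow> 'e::field) \<Rightarrow> ('f \<Rightarrow> 'e alg_closure) set" where
  "embeddings_over iF iE = {\<tau>. field_embedding \<tau> \<and> (\<forall>a. \<tau> (iF a) = to_ac (iE a))}"

definition weil_component ::
  "'f set \<Rightarrow> ('f::field \<Rightarrow> 'l::field) \<Rightarrow> ('f \<Rightarrow> 'l^'n^'n::finite) \<Rightarrow> 'l^'n^'n" where
  "weil_component C \<tau> x = (\<chi> i j. \<Sum>c\<in>C. \<tau> c * x c $ i $ j)"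

definition weil_points ::
  "('q::field \<Rightarrow> 'f::field) \<Rightarrow> ('q \<Rightarrow> 'e::field) \<Rightarrow> 'f set \<Rightarrow>
   ('n::finite \<times> 'n, 'f) mpolynomial set \<Rightarrow> ('f \<Rightarrow> 'e alg_closure^'n^'n) set" where
  "weil_points iF iE C S =
     {x. (\<forall>c. c \<notin> C \<longrightarrow> x c = 0) \<and>
         (\<forall>\<tau>\<in>embeddings_over iF iE. weil_component C \<tau> x \<in> gpoints \<tau> S)}"

text \<open>Regular functions over \<open>E\<close> on the Weil restriction are polynomials in the coordinates
  (\<open>Some (c, i, j)\<close>) and in the inverse of the norm of the determinant (\<open>None\<close>).\<close>

definition weil_coords ::
  "('q::field \<Rightarrow> 'f::field) \<Rightarrow> ('q \<Rightarrow> 'e::field) \<Rightarrow> 'f set \<Rightarrow>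
   ('f \<Rightarrow> 'e alg_closure^'n^'n::finite) \<Rightarrow> ('f \<times> 'n \<times> 'n) option \<Rightarrow> 'e alg_closure" where
  "weil_coords iF iE C x v =
     (case v of
        None \<Rightarrow> inverse (\<Prod>\<tau>\<in>embeddings_over iF iE. det (weil_component C \<tau> x))
      | Some (c, i, j) \<Rightarrow> x c $ i $ j)"

definition weil_eval ::
  "('q::field \<Rightarrow> 'f::field) \<Rightarrow> ('q \<Rightarrow> 'e::field) \<Rightarrow> 'f set \<Rightarrow>
   (('f \<times> 'n \<times> 'n) option, 'e) mpolynomial \<Rightarrow> ('f \<Rightarrow> 'e alg_closure^'n^'n::finite) \<Rightarrow>
   'e alg_closure" where
  "weil_eval iF iE C P x = mpeval to_ac (weil_coords iF iE C x) P"

text \<open>The \<open>\<rat>\<^sub>p\<close>-point of the Weil restriction corresponding to a matrix over \<open>F\<close>.\<close>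

definition weil_of_rational ::
  "('q::field \<Rightarrow> 'f::field) \<Rightarrow> ('q \<Rightarrow> 'e::field) \<Rightarrow> 'f set \<Rightarrow> 'f^'n^'n::finite \<Rightarrow>
   'f \<Rightarrow> 'e alg_closure^'n^'n" where
  "weil_of_rational iF iE C g c =
     (\<chi> i j. to_ac (iE (module.representation (\<lambda>a y. iF a * y) C (g $ i $ j) c)))"

text \<open>A finite-dimensional algebraic representation over \<open>E\<close> of the Weil restriction is a
  homomorphism to a general linear group whose matrix coefficients \<open>P b b'\<close>, with respect to a
  basis \<open>B\<close>, are regular functions over \<open>E\<close>; \<open>\<sigma>\<close> is its restriction to the group of rational
  points.\<close>

definition algebraic_rep ::
  "('q::field \<Rightarrow> 'f::field) \<Rightarrow> ('q \<Rightarrow> 'e::field) \<Rightarrow> ('e \<Rightarrow> 'w::ab_group_add \<Rightarrow> 'w) \<Rightarrow>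
   ('n::finite \<times> 'n, 'f) mpolynomial set \<Rightarrow> ('f^'n^'n \<Rightarrow> 'w \<Rightarrow> 'w) \<Rightarrow> bool" where
  "algebraic_rep iF iE sc S \<sigma> \<longleftrightarrow>
     group_rep sc (rational_points S) \<sigma> \<and>
     (\<exists>C B P. vs_basis (\<lambda>a y. iF a * y) C \<and> finite B \<and> vs_basis sc B \<and>
        (\<forall>x\<in>weil_points iF iE C S. (\<forall>\<tau>\<in>embeddings_over iF iE. weil_component C \<tau> x = mat 1) \<longrightarrow>
           (\<forall>b\<in>B. \<forall>b'\<in>B. weil_eval iF iE C (P b b') x = (if b = b' then 1 else 0))) \<and>
        (\<forall>x\<in>weil_points iF iE C S. \<forall>y\<in>weil_points iF iE C S. \<forall>z\<in>weil_points iF iE C S.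
           (\<forall>\<tau>\<in>embeddings_over iF iE.
              weil_component C \<tau> z = weil_component C \<tau> x ** weil_component C \<tau> y) \<longrightarrow>
           (\<forall>b\<in>B. \<forall>b'\<in>B. weil_eval iF iE C (P b b') z =
              (\<Sum>b''\<in>B. weil_eval iF iE C (P b b'') x * weil_eval iF iE C (P b'' b') y))) \<and>
        (\<forall>g\<in>rational_points S. \<forall>b\<in>B. \<forall>b'\<in>B.
           to_ac (module.representation sc B (\<sigma> g b') b) =
             weil_eval iF iE C (P b b') (weil_of_rational iF iE C g)))"


section \<open>Tensor products\<close>

text \<open>\<open>(V, t)\<close> is a tensor product if the linear extension of \<open>t\<close> to the free vector space on
  pairs identifies \<open>V\<close> with its quotient by the subspace of bilinear relations.\<close>

definition bilinear_relations ::
  "('e::field \<Rightarrow> 'a::ab_group_add \<Rightarrow> 'a) \<Rightarrow> ('e \<Rightarrow> 'b::ab_group_add \<Rightarrow> 'b) \<Rightarrow>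
   ('a \<times> 'b \<Rightarrow>\<^sub>0 'e) set" where
  "bilinear_relations sA sB =
     {Poly_Mapping.single (a + a', b) 1 - Poly_Mapping.single (a, b) 1
        - Poly_Mapping.single (a', b) 1 | a a' b. True} \<union>
     {Poly_Mapping.single (a, b + b') 1 - Poly_Mapping.single (a, b) 1
        - Poly_Mapping.single (a, b') 1 | a b b'. True} \<union>
     {Poly_Mapping.single (sA k a, b) 1 - Poly_Mapping.single (a, b) k | k a b. True} \<union>
     {Poly_Mapping.single (a, sB k b) 1 - Poly_Mapping.single (a, b) k | k a b. True}"

definition tensor_product ::
  "('e::field \<Rightarrow> 'a::ab_group_add \<Rightarrow> 'a) \<Rightarrow> ('e \<Rightarrow> 'b::ab_group_add \<Rightarrow> 'b) \<Rightarrow>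
   ('e \<Rightarrow> 'v::ab_group_add \<Rightarrow> 'v) \<Rightarrow> ('a \<Rightarrow> 'b \<Rightarrow> 'v) \<Rightarrow> bool" where
  "tensor_product sA sB sV t \<longleftrightarrow>
     vector_space sA \<and> vector_space sB \<and> vector_space sV \<and>
     (let ext = (\<lambda>x. \<Sum>(a, b)\<in>Poly_Mapping.keys x. sV (Poly_Mapping.lookup x (a, b)) (t a b)) in
        surj ext \<and>
        {x. ext x = 0} = module.span (\<lambda>k. Poly_Mapping.map ((*) k)) (bilinear_relations sA sB))"

definition diagonal_action ::
  "('e::field \<Rightarrow> 'v::ab_group_add \<Rightarrow> 'v) \<Rightarrow> ('a \<Rightarrow> 'b \<Rightarrow> 'v) \<Rightarrow> 'g set \<Rightarrow>
   ('g \<Rightarrow> 'a \<Rightarrow> 'a) \<Rightarrow> ('g \<Rightarrow> 'b \<Rightarrow> 'b) \<Rightarrow> ('g \<Rightarrow> 'v \<Rightarrow> 'v) \<Rightarrow> bool" where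
  "diagonal_action sV t G \<pi> \<sigma> \<rho> \<longleftrightarrow>
     (\<forall>g\<in>G. Vector_Spaces.linear sV sV (\<rho> g) \<and> (\<forall>a b. \<rho> g (t a b) = t (\<pi> g a) (\<sigma> g b)))"


section \<open>Norms\<close>

definition vnorm ::
  "('e::field \<Rightarrow> real) \<Rightarrow> ('e \<Rightarrow> 'v::ab_group_add \<Rightarrow> 'v) \<Rightarrow> ('v \<Rightarrow> real) \<Rightarrow> bool" where
  "vnorm N sc \<alpha> \<longleftrightarrow>
     (\<forall>v. 0 \<le> \<alpha> v) \<and> (\<forall>k v. \<alpha> (sc k v) = N k * \<alpha> v) \<and>
     (\<forall>v w. \<alpha> (v + w) \<le> max (\<alpha> v) (\<alpha> w)) \<and> (\<forall>v. \<alpha> v = 0 \<longrightarrow> v = 0)"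

text \<open>The supremum is taken in \<open>[0, \<infinity>]\<close>; in particular it is \<open>0\<close> on the zero space.\<close>

definition d_inf :: "('v::zero \<Rightarrow> real) \<Rightarrow> ('v \<Rightarrow> real) \<Rightarrow> ennreal" where
  "d_inf \<alpha> \<beta> = (SUP v\<in>{v. v \<noteq> 0}. ennreal \<bar>ln (\<alpha> v / \<beta> v)\<bar>)"

definition norm_component ::
  "('e::field \<Rightarrow> real) \<Rightarrow> ('e \<Rightarrow> 'v::ab_group_add \<Rightarrow> 'v) \<Rightarrow> ('v \<Rightarrow> real) \<Rightarrow> ('v \<Rightarrow> real) set" where
  "norm_component N sc \<alpha>\<^sub>0 = {\<alpha>. vnorm N sc \<alpha> \<and> d_inf \<alpha> \<alpha>\<^sub>0 < \<infinity>}"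

text \<open>The real-valued metric that \<open>d_inf\<close> induces on a component.\<close>

definition norm_dist :: "('v::zero \<Rightarrow> real) \<Rightarrow> ('v \<Rightarrow> real) \<Rightarrow> real" where
  "norm_dist \<alpha> \<beta> = enn2real (d_inf \<alpha> \<beta>)"

lemma d_inf_commute: "d_inf \<alpha> \<beta> = d_inf \<beta> \<alpha>"
  unfolding d_inf_def by (rule SUP_cong) (auto simp: ln_div abs_minus_commute)

lemma Metric_space_norm_component:
  assumes "nonarch_absolute_value N" and "vector_space sc" and "vnorm N sc \<alpha>\<^sub>0"
  shows "Metric_space (norm_component N sc \<alpha>\<^sub>0) norm_dist"
proof -
  have zero: "\<alpha> 0 = 0" if "vnorm N sc \<alpha>" for \<alpha>
  proof -
    have "sc 0 0 = 0"
      using assms(2) by (simp add: module.scale_zero_left module_iff_vector_space)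
    moreover have "\<alpha> (sc 0 0) = N 0 * \<alpha> 0"
      using that unfolding vnorm_def by blast
    moreover have "N 0 = 0"
      using assms(1) unfolding nonarch_absolute_value_def by blast
    ultimately show ?thesis by simp
  qed
  have pos: "\<alpha> v > 0" if "vnorm N sc \<alpha>" "v \<noteq> 0" for \<alpha> v
    using that unfolding vnorm_def by (metis order_le_less)
  have ratio: "ln (\<alpha> v / \<beta> v) = ln (\<alpha> v) - ln (\<beta> v)"
    if "vnorm N sc \<alpha>" "vnorm N sc \<beta>" "v \<noteq> 0" for \<alpha> \<beta> v
    using pos[OF that(1,3)] pos[OF that(2,3)] by (simp add: ln_div)
  have tri: "d_inf \<alpha> \<gamma> \<le> d_inf \<alpha> \<beta> + d_inf \<beta> \<gamma>"
    if "vnorm N sc \<alpha>" "vnorm N sc \<beta>" "vnorm N sc \<gamma>" for \<alpha> \<beta> \<gamma>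
    unfolding d_inf_def[of \<alpha> \<gamma>]
  proof (rule SUP_least)
    fix v :: 'b assume v: "v \<in> {v. v \<noteq> 0}"
    have "ennreal \<bar>ln (\<alpha> v / \<gamma> v)\<bar> \<le> ennreal (\<bar>ln (\<alpha> v / \<beta> v)\<bar> + \<bar>ln (\<beta> v / \<gamma> v)\<bar>)"
      using v by (intro ennreal_leI) (simp add: ratio that)
    also have "\<dots> = ennreal \<bar>ln (\<alpha> v / \<beta> v)\<bar> + ennreal \<bar>ln (\<beta> v / \<gamma> v)\<bar>"
      by simp
    also have "\<dots> \<le> d_inf \<alpha> \<beta> + d_inf \<beta> \<gamma>"
      unfolding d_inf_def using v by (intro add_mono SUP_upper)
    finally show "ennreal \<bar>ln (\<alpha> v / \<gamma> v)\<bar> \<le> d_inf \<alpha> \<beta> + d_inf \<beta> \<gamma>" .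
  qed
  have fin: "d_inf \<alpha> \<beta> < \<infinity>"
    if "\<alpha> \<in> norm_component N sc \<alpha>\<^sub>0" "\<beta> \<in> norm_component N sc \<alpha>\<^sub>0" for \<alpha> \<beta>
  proof -
    have "d_inf \<alpha> \<beta> \<le> d_inf \<alpha> \<alpha>\<^sub>0 + d_inf \<beta> \<alpha>\<^sub>0"
      using tri[of \<alpha> \<alpha>\<^sub>0 \<beta>] d_inf_commute[of \<beta> \<alpha>\<^sub>0] that assms(3) by (simp add: norm_component_def)
    also have "\<dots> < \<infinity>"
      using that by (simp add: norm_component_def)
    finally show ?thesis .
  qed
  have eq: "\<alpha> = \<beta>" if "vnorm N sc \<alpha>" "vnorm N sc \<beta>" "d_inf \<alpha> \<beta> = 0" for \<alpha> \<beta>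
  proof
    fix v
    show "\<alpha> v = \<beta> v"
    proof (cases "v = 0")
      case False
      have "ennreal \<bar>ln (\<alpha> v / \<beta> v)\<bar> \<le> d_inf \<alpha> \<beta>"
        unfolding d_inf_def using False by (intro SUP_upper) simp
      then have "ln (\<alpha> v / \<beta> v) = 0"
        using that(3) by (simp add: ennreal_eq_0_iff)
      then show ?thesis
        using ratio[OF that(1,2) False] pos[OF that(1) False] pos[OF that(2) False] by simp
    qed (simp add: zero that)
  qed
  have refl: "d_inf \<alpha> \<alpha> = 0" if "vnorm N sc \<alpha>" for \<alpha>
    unfolding d_inf_def using that by (auto simp: ratio intro!: antisym SUP_least)
  have mem: "vnorm N sc \<alpha>" if "\<alpha> \<in> norm_component N sc \<alpha>\<^sub>0" for \<alpha>
    using that by (simp add: norm_component_def)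
  show ?thesis
  proof
    fix \<alpha> \<beta> assume a: "\<alpha> \<in> norm_component N sc \<alpha>\<^sub>0" and b: "\<beta> \<in> norm_component N sc \<alpha>\<^sub>0"
    show "norm_dist \<alpha> \<beta> = 0 \<longleftrightarrow> \<alpha> = \<beta>"
      using fin[OF a b] eq[OF mem[OF a] mem[OF b]] refl[OF mem[OF a]]
      by (auto simp: norm_dist_def enn2real_eq_0_iff)
  next
    fix \<alpha> \<beta> \<gamma>
    assume a: "\<alpha> \<in> norm_component N sc \<alpha>\<^sub>0" and b: "\<beta> \<in> norm_component N sc \<alpha>\<^sub>0"
      and c: "\<gamma> \<in> norm_component N sc \<alpha>\<^sub>0"
    have "enn2real (d_inf \<alpha> \<gamma>) \<le> enn2real (d_inf \<alpha> \<beta> + d_inf \<beta> \<gamma>)"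
      using tri[OF mem[OF a] mem[OF b] mem[OF c]] fin[OF a b] fin[OF b c]
      by (intro enn2real_mono) simp_all
    also have "\<dots> = enn2real (d_inf \<alpha> \<beta>) + enn2real (d_inf \<beta> \<gamma>)"
      using fin[OF a b] fin[OF b c] by (simp add: enn2real_plus)
    finally show "norm_dist \<alpha> \<gamma> \<le> norm_dist \<alpha> \<beta> + norm_dist \<beta> \<gamma>"
      by (simp add: norm_dist_def)
  next
    fix \<alpha> \<beta> :: "'b \<Rightarrow> real"
    show "0 \<le> norm_dist \<alpha> \<beta>"
      by (simp add: norm_dist_def)
    show "norm_dist \<alpha> \<beta> = norm_dist \<beta> \<alpha>"
      by (simp add: norm_dist_def d_inf_commute)
  qed
qed

definition norm_diam :: "('v::zero \<Rightarrow> real) set \<Rightarrow> ennreal" where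
  "norm_diam \<A> = (SUP \<alpha>\<in>\<A>. SUP \<beta>\<in>\<A>. d_inf \<alpha> \<beta>)"

definition enclosing_radii ::
  "('e::field \<Rightarrow> real) \<Rightarrow> ('e \<Rightarrow> 'v::ab_group_add \<Rightarrow> 'v) \<Rightarrow> ('v \<Rightarrow> real) \<Rightarrow> ('v \<Rightarrow> real) set \<Rightarrow>
   real set" where
  "enclosing_radii N sc \<alpha>\<^sub>0 \<A> =
     {r. \<exists>\<beta>\<in>norm_component N sc \<alpha>\<^sub>0.
           \<A> \<subseteq> Metric_space.mcball (norm_component N sc \<alpha>\<^sub>0) norm_dist \<beta> r}"

definition circumradius ::
  "('e::field \<Rightarrow> real) \<Rightarrow> ('e \<Rightarrow> 'v::ab_group_add \<Rightarrow> 'v) \<Rightarrow> ('v \<Rightarrow> real) \<Rightarrow> ('v \<Rightarrow> real) set \<Rightarrow>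
   real" where
  "circumradius N sc \<alpha>\<^sub>0 \<A> = Inf (enclosing_radii N sc \<alpha>\<^sub>0 \<A>)"

end

theory Submission
  imports Defs
begin

text \<open>
  For norms, \<open>d_inf \<alpha> \<beta> \<le> r\<close> is a two-sided multiplicative comparison: each of \<open>\<alpha>\<close> and \<open>\<beta>\<close> is at
  most \<open>exp r\<close> times the other (\<open>d_inf_le_iff\<close>). The norms of a family of diameter \<open>D\<close> take at
  \<open>v\<close> values with ratios at most \<open>exp D\<close>, so their supremum \<open>s v\<close> satisfies
  \<open>\<gamma> v \<le> s v \<le> exp D * \<gamma> v\<close> for every member \<open>\<gamma>\<close>. Rescaling \<open>s\<close> by \<open>exp (- D / 2)\<close> splits this
  one-sided error evenly and gives a function within \<open>D / 2\<close> of every member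
  (\<open>d_inf_half_diam_centre_le\<close>).

  As \<open>d_inf\<close> is a sup distance between logarithms, the first candidate for a centre is the pointwise
  geometric mean of the supremum and the infimum of the family. But that function need not be a
  norm: the ultrametric inequality passes to suprema (\<open>vnorm_SUP\<close>), not to infima. The rescaled
  supremum attains the same radius without leaving the set of norms.

  No smaller radius is possible by the triangle inequality: two members of a ball of radius \<open>r\<close>
  are at distance at most \<open>2 * r\<close> (\<open>norm_diam_le_enclosing\<close>).
\<close>

section \<open>Norms and multiplicative comparison\<close>

lemma vnorm_zero:
  assumes "nonarch_absolute_value N" and "vector_space sc" and "vnorm N sc \<alpha>"
  shows "\<alpha> 0 = 0"
proof -
  have "\<alpha> (sc 0 0) = N 0 * \<alpha> 0"
    using assms(3) unfolding vnorm_def by blast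
  moreover have "N 0 = 0"
    using assms(1) unfolding nonarch_absolute_value_def by blast
  ultimately show ?thesis
    using assms(2) by (simp add: module.scale_zero_left module_iff_vector_space)
qed

lemma vnorm_pos: "vnorm N sc \<alpha> \<Longrightarrow> v \<noteq> 0 \<Longrightarrow> \<alpha> v > 0"
  unfolding vnorm_def by (metis order_le_less)

lemma vnorm_scale:
  assumes "vnorm N sc \<alpha>" and "k > 0"
  shows "vnorm N sc (\<lambda>v. k * \<alpha> v)"
proof -
  have "k * \<alpha> (v + w) \<le> max (k * \<alpha> v) (k * \<alpha> w)" for v w
  proof -
    have "k * \<alpha> (v + w) \<le> k * max (\<alpha> v) (\<alpha> w)"
      using assms by (intro mult_left_mono) (auto simp: vnorm_def)
    also have "\<dots> = max (k * \<alpha> v) (k * \<alpha> w)"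
      using assms(2) by (simp add: max_mult_distrib_left)
    finally show ?thesis .
  qed
  then show ?thesis
    using assms unfolding vnorm_def by (auto simp: algebra_simps)
qed

lemma abs_ln_divide_le_iff:
  fixes x y r :: real
  assumes "x > 0" and "y > 0"
  shows "\<bar>ln (x / y)\<bar> \<le> r \<longleftrightarrow> x \<le> exp r * y \<and> y \<le> exp r * x"
proof -
  have "x \<le> exp r * y \<longleftrightarrow> ln x \<le> r + ln y"
    using assms by (metis exp_gt_zero ln_exp ln_le_cancel_iff ln_mult_pos mult_pos_pos)
  moreover have "y \<le> exp r * x \<longleftrightarrow> ln y \<le> r + ln x"
    using assms by (metis exp_gt_zero ln_exp ln_le_cancel_iff ln_mult_pos mult_pos_pos)
  ultimately show ?thesis
    using assms by (auto simp: ln_div)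
qed

text \<open>Turning the extended-real supremum into pointwise inequalities reduces all later distance
  estimates to products of reals. The bound at the zero vector is vacuous in \<open>d_inf\<close> and true
  because norms vanish there.\<close>

lemma d_inf_le_iff:
  assumes "nonarch_absolute_value N" and "vector_space sc"
    and "vnorm N sc \<alpha>" and "vnorm N sc \<beta>" and "0 \<le> r"
  shows "d_inf \<alpha> \<beta> \<le> ennreal r \<longleftrightarrow> (\<forall>v. \<alpha> v \<le> exp r * \<beta> v \<and> \<beta> v \<le> exp r * \<alpha> v)"
proof -
  have "d_inf \<alpha> \<beta> \<le> ennreal r \<longleftrightarrow> (\<forall>v. v \<noteq> 0 \<longrightarrow> \<bar>ln (\<alpha> v / \<beta> v)\<bar> \<le> r)"
    unfolding d_inf_def using \<open>0 \<le> r\<close> by (auto simp: SUP_le_iff)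
  also have "\<dots> \<longleftrightarrow> (\<forall>v. v \<noteq> 0 \<longrightarrow> \<alpha> v \<le> exp r * \<beta> v \<and> \<beta> v \<le> exp r * \<alpha> v)"
    using vnorm_pos[OF assms(3)] vnorm_pos[OF assms(4)] by (auto simp: abs_ln_divide_le_iff)
  also have "\<dots> \<longleftrightarrow> (\<forall>v. \<alpha> v \<le> exp r * \<beta> v \<and> \<beta> v \<le> exp r * \<alpha> v)"
    using vnorm_zero[OF assms(1-3)] vnorm_zero[OF assms(1,2,4)] by (metis mult_zero_right order_refl)
  finally show ?thesis .
qed

lemma d_inf_triangle_le:
  assumes "nonarch_absolute_value N" and "vector_space sc"
    and "vnorm N sc \<alpha>" and "vnorm N sc \<beta>" and "vnorm N sc \<gamma>"
    and "0 \<le> r" and "0 \<le> s" and "d_inf \<alpha> \<beta> \<le> ennreal r" and "d_inf \<beta> \<gamma> \<le> ennreal s"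
  shows "d_inf \<alpha> \<gamma> \<le> ennreal (r + s)"
proof -
  have *: "x \<le> exp (r + s) * z" if "x \<le> exp t * y" "y \<le> exp u * z" "t + u = r + s"
    for x y z t u :: real
  proof -
    have "exp t * y \<le> exp t * (exp u * z)"
      using that(2) by simp
    then show ?thesis
      using that(1,3) by (metis exp_add mult.assoc order_trans)
  qed
  have 1: "\<alpha> v \<le> exp r * \<beta> v" "\<beta> v \<le> exp r * \<alpha> v" "\<beta> v \<le> exp s * \<gamma> v" "\<gamma> v \<le> exp s * \<beta> v" for v
    using d_inf_le_iff[OF assms(1-4,6)] d_inf_le_iff[OF assms(1,2,4,5,7)] assms(8,9) by blast+
  have "\<alpha> v \<le> exp (r + s) * \<gamma> v \<and> \<gamma> v \<le> exp (r + s) * \<alpha> v" for v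
    using *[OF 1(1) 1(3)] *[OF 1(4) 1(2)] by (simp add: add.commute)
  then show ?thesis
    using d_inf_le_iff[OF assms(1-3,5), of "r + s"] assms(6,7) by simp
qed

lemma d_inf_finite_on_component:
  assumes "nonarch_absolute_value N" and "vector_space sc" and "vnorm N sc \<alpha>\<^sub>0"
    and "\<alpha> \<in> norm_component N sc \<alpha>\<^sub>0" and "\<beta> \<in> norm_component N sc \<alpha>\<^sub>0"
  shows "d_inf \<alpha> \<beta> < \<infinity>"
proof -
  have fin: "d_inf \<gamma> \<alpha>\<^sub>0 \<le> ennreal (enn2real (d_inf \<gamma> \<alpha>\<^sub>0))" if "\<gamma> \<in> norm_component N sc \<alpha>\<^sub>0" for \<gamma>
    using that by (simp add: norm_component_def)
  have vn: "vnorm N sc \<alpha>" "vnorm N sc \<beta>"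
    using assms(4,5) by (simp_all add: norm_component_def)
  have "d_inf \<alpha> \<beta> \<le> ennreal (enn2real (d_inf \<alpha> \<alpha>\<^sub>0) + enn2real (d_inf \<beta> \<alpha>\<^sub>0))"
    using fin[OF assms(4)] fin[OF assms(5)] d_inf_commute[of \<beta> \<alpha>\<^sub>0]
    by (intro d_inf_triangle_le[OF assms(1,2) vn(1) assms(3) vn(2)]) simp_all
  also have "\<dots> < \<infinity>"
    by simp
  finally show ?thesis .
qed

section \<open>Enclosing balls and the diameter\<close>

text \<open>The real-valued metric \<open>norm_dist\<close> sends an infinite distance to \<open>0\<close>, so passing between
  balls and \<open>d_inf\<close> relies on distances being finite within a component.\<close>

lemma enclosing_radii_iff:
  assumes "nonarch_absolute_value N" and "vector_space sc" and "vnorm N sc \<alpha>\<^sub>0"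
    and "\<A> \<subseteq> norm_component N sc \<alpha>\<^sub>0" and "\<A> \<noteq> {}"
  shows "r \<in> enclosing_radii N sc \<alpha>\<^sub>0 \<A> \<longleftrightarrow>
    0 \<le> r \<and> (\<exists>\<beta>\<in>norm_component N sc \<alpha>\<^sub>0. \<forall>\<gamma>\<in>\<A>. d_inf \<beta> \<gamma> \<le> ennreal r)"
proof -
  interpret Metric_space "norm_component N sc \<alpha>\<^sub>0" norm_dist
    by (rule Metric_space_norm_component[OF assms(1-3)])
  have dist: "norm_dist \<beta> \<gamma> \<le> r \<longleftrightarrow> 0 \<le> r \<and> d_inf \<beta> \<gamma> \<le> ennreal r"
    if "\<beta> \<in> norm_component N sc \<alpha>\<^sub>0" "\<gamma> \<in> \<A>" for \<beta> \<gamma>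
  proof -
    have "d_inf \<beta> \<gamma> = ennreal (norm_dist \<beta> \<gamma>)"
      using d_inf_finite_on_component[OF assms(1-3) that(1)] that(2) assms(4)
      by (auto simp: norm_dist_def)
    moreover have "0 \<le> r" if "norm_dist \<beta> \<gamma> \<le> r"
      using nonneg that by (rule order_trans)
    ultimately show ?thesis
      by (metis ennreal_le_iff)
  qed
  have ball: "\<A> \<subseteq> mcball \<beta> r \<longleftrightarrow> 0 \<le> r \<and> (\<forall>\<gamma>\<in>\<A>. d_inf \<beta> \<gamma> \<le> ennreal r)"
    if \<beta>: "\<beta> \<in> norm_component N sc \<alpha>\<^sub>0" for \<beta>
  proof -
    have "\<A> \<subseteq> mcball \<beta> r \<longleftrightarrow> (\<forall>\<gamma>\<in>\<A>. norm_dist \<beta> \<gamma> \<le> r)"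
      using \<beta> assms(4) unfolding subset_iff in_mcball by blast
    also have "\<dots> \<longleftrightarrow> (\<forall>\<gamma>\<in>\<A>. 0 \<le> r \<and> d_inf \<beta> \<gamma> \<le> ennreal r)"
      using dist[OF \<beta>] by (rule ball_cong[OF refl])
    also have "\<dots> \<longleftrightarrow> 0 \<le> r \<and> (\<forall>\<gamma>\<in>\<A>. d_inf \<beta> \<gamma> \<le> ennreal r)"
      using assms(5) by blast
    finally show ?thesis .
  qed
  have "r \<in> enclosing_radii N sc \<alpha>\<^sub>0 \<A> \<longleftrightarrow> (\<exists>\<beta>\<in>norm_component N sc \<alpha>\<^sub>0. \<A> \<subseteq> mcball \<beta> r)"
    by (simp add: enclosing_radii_def)
  also have "\<dots> \<longleftrightarrow>
      (\<exists>\<beta>\<in>norm_component N sc \<alpha>\<^sub>0. 0 \<le> r \<and> (\<forall>\<gamma>\<in>\<A>. d_inf \<beta> \<gamma> \<le> ennreal r))"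
    by (rule bex_cong[OF refl ball])
  finally show ?thesis
    by blast
qed

lemma norm_diam_le_enclosing:
  assumes "nonarch_absolute_value N" and "vector_space sc" and "vnorm N sc \<alpha>\<^sub>0"
    and "\<A> \<subseteq> norm_component N sc \<alpha>\<^sub>0" and "\<A> \<noteq> {}"
    and "r \<in> enclosing_radii N sc \<alpha>\<^sub>0 \<A>"
  shows "norm_diam \<A> \<le> ennreal (2 * r)"
proof -
  obtain \<beta> where r: "0 \<le> r" and \<beta>: "vnorm N sc \<beta>" and le: "\<And>\<gamma>. \<gamma> \<in> \<A> \<Longrightarrow> d_inf \<beta> \<gamma> \<le> ennreal r"
    using assms(6) unfolding enclosing_radii_iff[OF assms(1-5)] by (auto simp: norm_component_def)
  have "d_inf \<gamma> \<delta> \<le> ennreal (2 * r)" if "\<gamma> \<in> \<A>" "\<delta> \<in> \<A>" for \<gamma> \<delta>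
  proof -
    have "vnorm N sc \<gamma>" "vnorm N sc \<delta>"
      using that assms(4) by (auto simp: norm_component_def)
    then have "d_inf \<gamma> \<delta> \<le> ennreal (r + r)"
      using \<beta> r le[OF that(2)] le[OF that(1)] d_inf_commute[of \<beta> \<gamma>]
      by (intro d_inf_triangle_le[OF assms(1,2), of \<gamma> \<beta> \<delta>]) simp_all
    then show ?thesis
      by simp
  qed
  then show ?thesis
    unfolding norm_diam_def by (intro SUP_least)
qed

lemma mbounded_enclosing_radius:
  assumes "nonarch_absolute_value N" and "vector_space sc" and "vnorm N sc \<alpha>\<^sub>0" and "\<A> \<noteq> {}"
    and "Metric_space.mbounded (norm_component N sc \<alpha>\<^sub>0) norm_dist \<A>"
  obtains r where "r \<in> enclosing_radii N sc \<alpha>\<^sub>0 \<A>"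
proof -
  interpret Metric_space "norm_component N sc \<alpha>\<^sub>0" norm_dist
    by (rule Metric_space_norm_component[OF assms(1-3)])
  obtain \<beta> r where "\<A> \<subseteq> mcball \<beta> r"
    using assms(5) unfolding mbounded_def by blast
  moreover from this have "\<beta> \<in> norm_component N sc \<alpha>\<^sub>0"
    using assms(4) by auto
  ultimately show thesis
    using that unfolding enclosing_radii_def by blast
qed

section \<open>The supremum of a bounded family as a centre\<close>

text \<open>The ultrametric inequality survives a pointwise supremum because \<open>max\<close> is monotone and each
  member's value is below the supremum; for infima the two values on the right could be nearly
  attained by different members. Definiteness is inherited from any single member.\<close>

lemma vnorm_SUP:
  assumes N: "nonarch_absolute_value N" and ne: "\<A> \<noteq> {}" and vn: "\<And>\<gamma>. \<gamma> \<in> \<A> \<Longrightarrow> vnorm N sc \<gamma>"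
    and bdd: "\<And>v. bdd_above ((\<lambda>\<gamma>. \<gamma> v) ` \<A>)"
  shows "vnorm N sc (\<lambda>v. SUP \<gamma>\<in>\<A>. \<gamma> v)"
proof -
  define s where "s = (\<lambda>v. SUP \<gamma>\<in>\<A>. \<gamma> v)"
  have up: "\<gamma> v \<le> s v" if "\<gamma> \<in> \<A>" for \<gamma> v
    unfolding s_def using bdd that by (intro cSUP_upper)
  have least: "s v \<le> b" if "\<And>\<gamma>. \<gamma> \<in> \<A> \<Longrightarrow> \<gamma> v \<le> b" for v b
    unfolding s_def using ne that by (intro cSUP_least)
  obtain \<gamma>\<^sub>0 where \<gamma>\<^sub>0: "\<gamma>\<^sub>0 \<in> \<A>"
    using ne by blast
  have nonneg: "0 \<le> s v" for v
    using up[OF \<gamma>\<^sub>0, of v] vn[OF \<gamma>\<^sub>0] unfolding vnorm_def by (metis order_trans)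
  have hom: "\<gamma> (sc k v) = N k * \<gamma> v" if "\<gamma> \<in> \<A>" for \<gamma> k v
    using vn[OF that] unfolding vnorm_def by blast
  have Nnn: "0 \<le> N k" for k
    using N unfolding nonarch_absolute_value_def by blast
  have "s (sc k v) = N k * s v" for k v
  proof (rule antisym)
    show "s (sc k v) \<le> N k * s v"
      by (rule least) (simp add: hom up Nnn mult_left_mono)
    show "N k * s v \<le> s (sc k v)"
    proof (cases "N k = 0")
      case False
      then have pos: "N k > 0"
        using Nnn[of k] by simp
      have "s v \<le> s (sc k v) / N k"
        using up[of _ "sc k v"] pos by (intro least) (simp add: hom pos_le_divide_eq mult.commute)
      then show ?thesis
        using pos by (simp add: pos_le_divide_eq mult.commute)
    qed (simp add: nonneg)
  qed
  moreover have "s (v + w) \<le> max (s v) (s w)" for v w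
  proof (rule least)
    fix \<gamma> assume \<gamma>: "\<gamma> \<in> \<A>"
    have "\<gamma> (v + w) \<le> max (\<gamma> v) (\<gamma> w)"
      using vn[OF \<gamma>] unfolding vnorm_def by blast
    also have "\<dots> \<le> max (s v) (s w)"
      using up[OF \<gamma>] by (rule max.mono[OF _ up[OF \<gamma>]])
    finally show "\<gamma> (v + w) \<le> max (s v) (s w)" .
  qed
  moreover have "v = 0" if "s v = 0" for v
    using up[OF \<gamma>\<^sub>0, of v] vnorm_pos[OF vn[OF \<gamma>\<^sub>0], of v] that by fastforce
  ultimately show ?thesis
    using nonneg unfolding vnorm_def s_def by blast
qed

text \<open>The comparison \<open>\<gamma> v \<le> s v \<le> exp D * \<gamma> v\<close> between a member and the supremum is lopsided; the
  factor \<open>exp (- D / 2)\<close> makes both errors equal to \<open>exp (D / 2)\<close>.\<close>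

lemma d_inf_half_diam_centre_le:
  fixes D :: real and \<A> :: "('v::ab_group_add \<Rightarrow> real) set"
  defines "c \<equiv> \<lambda>v. exp (- D / 2) * (SUP \<gamma>\<in>\<A>. \<gamma> v)"
  assumes N: "nonarch_absolute_value N" and sc: "vector_space sc"
    and ne: "\<A> \<noteq> {}" and vn: "\<And>\<gamma>. \<gamma> \<in> \<A> \<Longrightarrow> vnorm N sc \<gamma>"
    and D: "0 \<le> D" and diam: "norm_diam \<A> \<le> ennreal D"
  shows "bdd_above ((\<lambda>\<gamma>. \<gamma> v) ` \<A>)" and "vnorm N sc c"
    and "\<gamma> \<in> \<A> \<Longrightarrow> d_inf c \<gamma> \<le> ennreal (D / 2)"
proof -
  have close: "\<delta> v \<le> exp D * \<gamma> v" if "\<gamma> \<in> \<A>" "\<delta> \<in> \<A>" for \<gamma> \<delta> v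
  proof -
    have "d_inf \<delta> \<gamma> \<le> norm_diam \<A>"
      unfolding norm_diam_def using that by (intro SUP_upper2[of \<delta>] SUP_upper)
    then have "d_inf \<delta> \<gamma> \<le> ennreal D"
      using diam by (rule order_trans)
    then show ?thesis
      using d_inf_le_iff[OF N sc vn[OF that(2)] vn[OF that(1)] D] by blast
  qed
  show bdd: "bdd_above ((\<lambda>\<gamma>. \<gamma> v) ` \<A>)" for v
    using ne close by (meson bdd_aboveI2 ex_in_conv)
  show c: "vnorm N sc c"
    unfolding c_def by (intro vnorm_scale vnorm_SUP[OF N ne vn bdd]) simp_all
  show "d_inf c \<gamma> \<le> ennreal (D / 2)" if \<gamma>: "\<gamma> \<in> \<A>"
  proof -
    have "c v \<le> exp (D / 2) * \<gamma> v \<and> \<gamma> v \<le> exp (D / 2) * c v" for v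
    proof
      have "(SUP \<gamma>\<in>\<A>. \<gamma> v) \<le> exp D * \<gamma> v"
        using ne close[OF \<gamma>] by (intro cSUP_least)
      then have "c v \<le> exp (- D / 2) * (exp D * \<gamma> v)"
        by (simp add: c_def)
      also have "\<dots> = exp (D / 2) * \<gamma> v"
        unfolding mult.assoc[symmetric] exp_add[symmetric] by simp
      finally show "c v \<le> exp (D / 2) * \<gamma> v" .
      have "\<gamma> v \<le> (SUP \<gamma>\<in>\<A>. \<gamma> v)"
        using bdd \<gamma> by (intro cSUP_upper)
      also have "\<dots> = exp (D / 2) * c v"
        unfolding c_def mult.assoc[symmetric] exp_add[symmetric] by simp
      finally show "\<gamma> v \<le> exp (D / 2) * c v" .
    qed
    then show ?thesis
      using d_inf_le_iff[OF N sc c vn[OF \<gamma>], of "D / 2"] D by simp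
  qed
qed

section \<open>The circumradius\<close>

theorem theorem4p4:
  fixes p :: nat
    and absQ :: "'q::field_char_0 \<Rightarrow> real"
    and iF :: "'q \<Rightarrow> 'f::field" and absF :: "'f \<Rightarrow> real"
    and iE :: "'q \<Rightarrow> 'e::field" and absE :: "'e \<Rightarrow> real"
    and S :: "('n::finite \<times> 'n, 'f) mpolynomial set"
    and scaleP :: "'e \<Rightarrow> 'a::ab_group_add \<Rightarrow> 'a" and \<pi> :: "'f^'n^'n \<Rightarrow> 'a \<Rightarrow> 'a"
    and scaleW :: "'e \<Rightarrow> 'b::ab_group_add \<Rightarrow> 'b" and \<sigma> :: "'f^'n^'n \<Rightarrow> 'b \<Rightarrow> 'b"
    and scaleV :: "'e \<Rightarrow> 'v::ab_group_add \<Rightarrow> 'v" and \<rho> :: "'f^'n^'n \<Rightarrow> 'v \<Rightarrow> 'v"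
    and tens :: "'a \<Rightarrow> 'b \<Rightarrow> 'v"
    and \<alpha>\<^sub>0 :: "'v \<Rightarrow> real" and \<A> :: "('v \<Rightarrow> real) set"
    and D :: real and c :: "'v \<Rightarrow> real"
  assumes "is_padic_field p absQ"
    and "finite_extension iF" and "nonarch_absolute_value absF" and "\<forall>x. absF (iF x) = absQ x"
    and "finite_extension iE" and "nonarch_absolute_value absE" and "nontrivial_absolute_value absE"
    and "reductive_group S"
    and "smooth_admissible_rep absF scaleP (rational_points S) \<pi>"
    and "algebraic_rep iF iE scaleW S \<sigma>"
    and "tensor_product scaleP scaleW scaleV tens"
    and "diagonal_action scaleV tens (rational_points S) \<pi> \<sigma> \<rho>"
    and "vnorm absE scaleV \<alpha>\<^sub>0"
    and "\<A> \<subseteq> norm_component absE scaleV \<alpha>\<^sub>0" and "\<A> \<noteq> {}"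
    and "Metric_space.mbounded (norm_component absE scaleV \<alpha>\<^sub>0) norm_dist \<A>"
    and "D = enn2real (norm_diam \<A>)"
    and "c = (\<lambda>v. exp (- D / 2) * (SUP \<gamma>\<in>\<A>. \<gamma> v))"
  shows "(\<forall>v. bdd_above ((\<lambda>\<gamma>. \<gamma> v) ` \<A>)) \<and> vnorm absE scaleV c \<and>
         (SUP \<gamma>\<in>\<A>. d_inf c \<gamma>) \<le> ennreal (D / 2) \<and>
         D / 2 \<in> enclosing_radii absE scaleV \<alpha>\<^sub>0 \<A> \<and>
         (\<forall>r\<in>enclosing_radii absE scaleV \<alpha>\<^sub>0 \<A>. D / 2 \<le> r) \<and>
         circumradius absE scaleV \<alpha>\<^sub>0 \<A> = D / 2"
proof -
  have sc: "vector_space scaleV"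
    using assms(11) by (simp add: tensor_product_def)
  note ctx = assms(6) sc assms(13)
  let ?R = "enclosing_radii absE scaleV \<alpha>\<^sub>0 \<A>"
  have D0: "0 \<le> D"
    using assms(17) by simp
  obtain r\<^sub>0 where "r\<^sub>0 \<in> ?R"
    using mbounded_enclosing_radius[OF ctx assms(15,16)] by blast
  then have "norm_diam \<A> < \<infinity>"
    using norm_diam_le_enclosing[OF ctx assms(14,15)]
    by (metis ennreal_less_top infinity_ennreal_def le_less_trans)
  then have diam: "norm_diam \<A> = ennreal D"
    using assms(17) by simp
  have vn: "vnorm absE scaleV \<gamma>" if "\<gamma> \<in> \<A>" for \<gamma>
    using that assms(14) by (auto simp: norm_component_def)
  have bdd: "bdd_above ((\<lambda>\<gamma>. \<gamma> v) ` \<A>)" and c: "vnorm absE scaleV c"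
    and near: "\<And>\<gamma>. \<gamma> \<in> \<A> \<Longrightarrow> d_inf c \<gamma> \<le> ennreal (D / 2)" for v
    using d_inf_half_diam_centre_le[OF assms(6) sc assms(15) vn D0] diam
    unfolding assms(18) by simp_all
  have "c \<in> norm_component absE scaleV \<alpha>\<^sub>0"
  proof -
    obtain \<gamma> where \<gamma>: "\<gamma> \<in> \<A>"
      using assms(15) by blast
    then have "d_inf \<gamma> \<alpha>\<^sub>0 \<le> ennreal (enn2real (d_inf \<gamma> \<alpha>\<^sub>0))"
      using assms(14) by (auto simp: norm_component_def)
    then have "d_inf c \<alpha>\<^sub>0 \<le> ennreal (D / 2 + enn2real (d_inf \<gamma> \<alpha>\<^sub>0))"
      using D0 near[OF \<gamma>] by (intro d_inf_triangle_le[OF assms(6) sc c vn[OF \<gamma>] assms(13)]) simp_all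
    also have "\<dots> < \<infinity>"
      by simp
    finally show ?thesis
      using c by (simp add: norm_component_def)
  qed
  then have attained: "D / 2 \<in> ?R"
    using near D0 unfolding enclosing_radii_iff[OF ctx assms(14,15)] by auto
  have lower: "D / 2 \<le> r" if "r \<in> ?R" for r
  proof -
    have "0 \<le> r"
      using that unfolding enclosing_radii_iff[OF ctx assms(14,15)] by blast
    then show ?thesis
      using norm_diam_le_enclosing[OF ctx assms(14,15) that] diam by (simp add: ennreal_le_iff)
  qed
  have "circumradius absE scaleV \<alpha>\<^sub>0 \<A> = D / 2"
    unfolding circumradius_def using attained lower by (rule cInf_eq_minimum)
  then show ?thesis
    using bdd c near attained lower by (auto intro: SUP_least)
qed

end
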